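(* Let $N\geq 2$ and $s\in(0,1]$. Then (i) for any $m\in\mathbb{N}$, $\mathcal{H}_m^s(\mathbb{R}^N)=\mathcal{H}_m^1(\mathbb{R}^N)$; (ii) $\mathcal{H}^1(\mathbb{R}^N)\subset\mathcal{H}^s(\mathbb{R}^N)$.
   Context: Let $N\in\mathbb{N}$ and $s\in(0,1)$ with $N>2s$. The fractional Laplacian is defined by $(-\Delta)^s u(x)=\lim_{\epsilon\to0^+}c_{N,s}\int_{B_{1/\epsilon}\setminus B_\epsilon}\frac{u(x)-u(x+z)}{|z|^{N+2s}}\,dz$, i.e. in the principal value sense both at the origin and at infinity, where $B_r$ is the ball of radius $r$ centered at $0$ and $c_{N,s}=2^{2s}\pi^{-N/2}s\,\Gamma(\frac{N+2s}{2})/\Gamma(1-s)>0$. For $s=1$, $(-\Delta)^1$ denotes the classical operator $-\Delta$. Here $\mathbb{N}$ is the set of nonnegative integers. For $k\in\mathbb{N}$, $\mathbb{P}_k(\mathbb{R}^N)=\{\sum_{|\alpha|=k}b_\alpha x^\alpha:\ \alpha\in\mathbb{N}^N,\ b_\alpha\in\mathbb{R}\}$ is the set of homogeneous polynomials of order $k$, with $x^\alpha=\prod_{i=1}^N x_i^{\alpha_i}$. For $s\in(0,1]$, $\mathcal{H}^s(\mathbb{R}^N)$ denotes the set of all $s$-harmonic functions in $\mathbb{R}^N$, i.e. classical solutions of $(-\Delta)^s u=0$ in $\mathbb{R}^N$, and $\mathcal{H}_m^s(\mathbb{R}^N)=\{u\in\mathbb{P}_m(\mathbb{R}^N):\ u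 \text{ is } s\text{-harmonic in } \mathbb{R}^N\}$. In particular $\mathcal{H}_m^1(\mathbb{R}^N)$ is the set of harmonic homogeneous polynomials of order $m$ and $\mathcal{H}^1(\mathbb{R}^N)$ is the set of harmonic functions in $\mathbb{R}^N$. *)

theory Defs
  imports "HOL-Analysis.Analysis"
begin

definition multi_indices :: "nat \<Rightarrow> ('n::finite \<Rightarrow> nat) set" where
  "multi_indices k = {\<alpha>. (\<Sum>i\<in>UNIV. \<alpha> i) = k}"

definition hom_poly :: "nat \<Rightarrow> (real^'n::finite \<Rightarrow> real) \<Rightarrow> bool" where
  "hom_poly k u \<longleftrightarrow> (\<exists>b :: ('n \<Rightarrow> nat) \<Rightarrow> real.
      u = (\<lambda>x. \<Sum>\<alpha>\<in>multi_indices k. b \<alpha> * (\<Prod>i\<in>UNIV. (x $ i) ^ \<alpha> i)))"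

definition c_const :: "nat \<Rightarrow> real \<Rightarrow> real" where
  "c_const N s = 2 powr (2 * s) * pi powr (- real N / 2) * s
      * Gamma ((real N + 2 * s) / 2) / Gamma (1 - s)"

text \<open>(-Delta)^s u (x) = L, in the principal value sense at 0 and at infinity
  (the truncated integrals being Lebesgue integrals over the annuli).\<close>
definition frac_lap_at :: "real \<Rightarrow> (real^'n::finite \<Rightarrow> real) \<Rightarrow> real^'n \<Rightarrow> real \<Rightarrow> bool" where
  "frac_lap_at s u x L \<longleftrightarrow>
     (\<forall>\<^sub>F \<epsilon> in at_right 0. set_integrable lborel (ball 0 (1/\<epsilon>) - ball 0 \<epsilon>)
         (\<lambda>z. (u x - u (x + z)) / norm z powr (real CARD('n) + 2 * s))) \<and>
     ((\<lambda>\<epsilon>. c_const CARD('n) s * (LINT z : ball 0 (1/\<epsilon>) - ball 0 \<epsilon> | lborel.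
         (u x - u (x + z)) / norm z powr (real CARD('n) + 2 * s))) \<longlongrightarrow> L) (at_right 0)"

definition classical_harmonic :: "(real^'n::finite \<Rightarrow> real) \<Rightarrow> bool" where
  "classical_harmonic u \<longleftrightarrow> (\<exists>(g :: real^'n \<Rightarrow> real^'n) (H :: real^'n \<Rightarrow> real^'n^'n).
      (\<forall>x. (u has_derivative (\<lambda>h. g x \<bullet> h)) (at x)) \<and>
      (\<forall>x. (g has_derivative (\<lambda>h. H x *v h)) (at x)) \<and>
      continuous_on UNIV H \<and>
      (\<forall>x. (\<Sum>i\<in>UNIV. H x $ i $ i) = 0))"

definition s_harmonic :: "real \<Rightarrow> (real^'n::finite \<Rightarrow> real) \<Rightarrow> bool" where
  "s_harmonic s u \<longleftrightarrow> (if s = 1 then classical_harmonic u else (\<forall>x. frac_lap_at s u x 0))"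

definition H_s :: "real \<Rightarrow> (real^'n::finite \<Rightarrow> real) set" where
  "H_s s = {u. s_harmonic s u}"

definition H_s_m :: "real \<Rightarrow> nat \<Rightarrow> (real^'n::finite \<Rightarrow> real) set" where
  "H_s_m s m = {u. hom_poly m u \<and> s_harmonic s u}"

end

theory Submission
  imports Defs "HOL-Computational_Algebra.Fundamental_Theorem_Algebra"
begin

text \<open>
  Write \<open>p = N + 2s > 2\<close> and let \<open>K(t)\<close> be the integral of \<open>u(x + tz) |z|^(-p)\<close> over an annulus
  \<open>a \<le> |z| < b\<close>.  On the annulus \<open>|z|^(-p) z = -\<nabla>\<phi>(z)\<close> for a Lipschitz, nonnegative, compactly
  supported radial function \<open>\<phi>\<close>, so integrating by parts gives
  \<open>K'(t) = t \<integral> \<phi>(z) \<Delta>u(x + tz) dz\<close>.  If \<open>u\<close> is harmonic, then \<open>K(1) = K(0)\<close> for every annulus,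
  i.e. all truncated integrals vanish.

  Conversely, if \<open>u\<close> is a polynomial, then so is \<open>K\<close>, and \<open>K'(0) = 0\<close> gives
  \<open>K(t) = K(0) + t\<^sup>2 q(t)\<close>.  Comparing the truncations at two consecutive dyadic scales, the inner
  shell contributes a quantity tending to 0, so s-harmonicity forces the contribution
  \<open>r^(2 - 2s) q(r)\<close> of the outer shell to tend to 0 along \<open>r = 2^n\<close>.  As \<open>2 - 2s > 0\<close>, this
  means \<open>q = 0\<close>; then \<open>K' = 0\<close>, and letting \<open>t \<rightarrow> 0\<close> in the formula for \<open>K'(t)/t\<close>
  yields \<open>\<Delta>u(x) = 0\<close>.
\<close>

section \<open>Integration by parts\<close>

text \<open>Dominated convergence applied to the difference quotients along an arbitrary sequence
  tending to \<open>t\<close>, with \<open>B\<close> as the majorant. Differentiability is asked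
  only at the point \<open>t\<close> and almost everywhere, because the radial weights used below
  have kinks on two spheres.\<close>

lemma has_real_derivative_integral:
  fixes F :: "real \<Rightarrow> 'a \<Rightarrow> real"
  assumes int: "\<And>h. \<bar>h\<bar> < 1 \<Longrightarrow> integrable M (F (t + h))"
    and der: "AE z in M. ((\<lambda>r. F r z) has_real_derivative F' z) (at t)"
    and lip: "\<And>z h. \<bar>h\<bar> < 1 \<Longrightarrow> \<bar>F (t + h) z - F t z\<bar> \<le> B z * \<bar>h\<bar>"
    and B: "integrable M B" and F': "F' \<in> borel_measurable M"
  shows "((\<lambda>r. \<integral>z. F r z \<partial>M) has_real_derivative (\<integral>z. F' z \<partial>M)) (at t)"
  unfolding has_field_derivative_iff tendsto_at_iff_sequentially
proof (intro allI impI)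
  fix X :: "nat \<Rightarrow> real"
  assume X: "\<forall>i. X i \<in> UNIV - {t}" and lim: "X \<longlonglongrightarrow> t"
  from LIMSEQ_D[OF lim, of 1] obtain N where N: "\<And>n. n \<ge> N \<Longrightarrow> \<bar>X n - t\<bar> < 1"
    by auto
  define Y where "Y n = X (n + N)" for n
  have Y: "\<bar>Y n - t\<bar> < 1" "Y n \<noteq> t" for n
    using N X by (auto simp: Y_def)
  have Ylim: "Y \<longlonglongrightarrow> t"
    unfolding Y_def using lim by (rule LIMSEQ_ignore_initial_segment)
  have intY: "integrable M (F (Y n))" for n
    using int[of "Y n - t"] Y by simp
  have intt: "integrable M (F t)"
    using int[of 0] by simp
  have "(\<lambda>n. \<integral>z. (F (Y n) z - F t z) / (Y n - t) \<partial>M) \<longlonglongrightarrow> (\<integral>z. F' z \<partial>M)"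
  proof (rule integral_dominated_convergence)
    show "(\<lambda>z. (F (Y n) z - F t z) / (Y n - t)) \<in> borel_measurable M" for n
      using intY intt by measurable
    show "AE z in M. (\<lambda>n. (F (Y n) z - F t z) / (Y n - t)) \<longlonglongrightarrow> F' z"
      using der
    proof eventually_elim
      case (elim z)
      then show ?case
        using Y Ylim unfolding has_field_derivative_iff tendsto_at_iff_sequentially
        by (auto simp: o_def)
    qed
    show "AE z in M. norm ((F (Y n) z - F t z) / (Y n - t)) \<le> B z" for n
      using lip[of "Y n - t"] Y by (auto simp: field_simps)
  qed (use B F' in auto)
  moreover have "(\<integral>z. (F (Y n) z - F t z) / (Y n - t) \<partial>M)
      = ((\<integral>z. F (Y n) z \<partial>M) - (\<integral>z. F t z \<partial>M)) / (Y n - t)" for n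
    using intY intt by (subst integral_divide_zero) auto
  ultimately have "(\<lambda>n. ((\<integral>z. F (X (n + N)) z \<partial>M) - (\<integral>z. F t z \<partial>M)) / (X (n + N) - t))
      \<longlonglongrightarrow> (\<integral>z. F' z \<partial>M)"
    unfolding Y_def by (simp only:)
  then show "((\<lambda>r. ((\<integral>z. F r z \<partial>M) - (\<integral>z. F t z \<partial>M)) / (r - t)) \<circ> X) \<longlonglongrightarrow> (\<integral>z. F' z \<partial>M)"
    unfolding o_def by (rule LIMSEQ_offset)
qed

lemma integrable_continuous_compact_support:
  fixes f :: "'a::euclidean_space \<Rightarrow> real"
  assumes "compact C" "continuous_on UNIV f" "\<And>z. z \<notin> C \<Longrightarrow> f z = 0"
  shows "integrable lborel f"
proof -
  have "integrable lborel (\<lambda>z. indicator C z *\<^sub>R f z)"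
    using assms by (intro borel_integrable_compact) (auto intro: continuous_on_subset)
  also have "(\<lambda>z. indicator C z *\<^sub>R f z) = f"
    using assms(3) by (force simp: indicator_def)
  finally show ?thesis .
qed

text \<open>Both sides are the derivative at \<open>h = 0\<close> of \<open>\<integral> \<phi>(z) v(z + he) dz = \<integral> \<phi>(z - he) v(z) dz\<close>,
  so \<open>\<phi>\<close> need only be Lipschitz.\<close>

lemma integral_by_parts_direction:
  fixes \<phi> v :: "'a::euclidean_space \<Rightarrow> real"
  assumes lip: "L-lipschitz_on UNIV \<phi>"
    and supp: "\<And>z. R \<le> norm z \<Longrightarrow> \<phi> z = 0"
    and d\<phi>: "AE z in lborel. ((\<lambda>h. \<phi> (z + h *\<^sub>R e)) has_real_derivative \<phi>' z) (at 0)"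
    and m\<phi>': "\<phi>' \<in> borel_measurable borel"
    and v: "continuous_on UNIV v" and v': "continuous_on UNIV v'"
    and dv: "\<And>z. ((\<lambda>h. v (z + h *\<^sub>R e)) has_real_derivative v' z) (at 0)"
  shows "(\<integral>z. \<phi> z * v' z \<partial>lborel) = - (\<integral>z. \<phi>' z * v z \<partial>lborel)"
proof -
  \<comment> \<open>\<open>C\<close> contains the supports of all translates of
    \<open>\<phi>\<close> by \<open>h *\<^sub>R e\<close> with |h| at most 1. The absolute value
    covers a negative \<open>R\<close>.\<close>
  define C where "C = cball (0::'a) (\<bar>R\<bar> + norm e)"
  have C: "compact C" unfolding C_def by simp
  have \<phi>c: "continuous_on UNIV \<phi>"
    using lip by (rule lipschitz_on_continuous_on)
  have vint: "integrable lborel (\<lambda>z. indicator C z * v z)"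
    using borel_integrable_compact[OF C continuous_on_subset[OF v]]
    by simp
  have abs_le: "\<phi> (z - h *\<^sub>R e) = 0" if "\<bar>h\<bar> \<le> 1" "z \<notin> C" for h z
  proof (rule supp)
    have "norm z \<le> norm (z - h *\<^sub>R e) + norm (h *\<^sub>R e)"
      by (metis diff_add_cancel norm_triangle_ineq)
    also have "norm (h *\<^sub>R e) \<le> norm e"
      using that mult_right_mono[of "\<bar>h\<bar>" 1 "norm e"] by simp
    finally show "R \<le> norm (z - h *\<^sub>R e)"
      using that by (auto simp: C_def)
  qed
  obtain V where V: "\<And>z. z \<in> C \<Longrightarrow> \<bar>v' z\<bar> \<le> V"
    using compact_imp_bounded[OF compact_continuous_image[OF continuous_on_subset[OF v'] C]]
    unfolding bounded_iff by (auto simp: image_iff)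
  have dv': "((\<lambda>h. v (z + h *\<^sub>R e)) has_real_derivative v' (z + k *\<^sub>R e)) (at k)" for z k
    using dv[of "z + k *\<^sub>R e"] DERIV_shift[of "\<lambda>h. v (z + h *\<^sub>R e)" _ 0 k]
    by (simp add: algebra_simps)
  \<comment> \<open>On the support of \<open>\<phi>\<close> the mean value bound makes
    \<open>v\<close> Lipschitz along \<open>e\<close>: the segments stay in \<open>C\<close>, where
    \<open>V\<close> bounds \<open>v'\<close>.\<close>
  have vlip: "\<bar>v (z + h *\<^sub>R e) - v z\<bar> \<le> V * \<bar>h\<bar>" if "\<bar>h\<bar> < 1" "norm z \<le> \<bar>R\<bar>" for z h
  proof -
    have "norm ((\<lambda>h. v (z + h *\<^sub>R e)) h - (\<lambda>h. v (z + h *\<^sub>R e)) 0) \<le> V * norm (h - 0)"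
    proof (rule field_differentiable_bound[where S = "{-1..1}" and f' = "\<lambda>k. v' (z + k *\<^sub>R e)"])
      fix k :: real assume k: "k \<in> {-1..1}"
      show "((\<lambda>h. v (z + h *\<^sub>R e)) has_field_derivative v' (z + k *\<^sub>R e)) (at k within {-1..1})"
        using dv' by (rule has_field_derivative_at_within)
      have "norm (z + k *\<^sub>R e) \<le> \<bar>R\<bar> + norm e"
        using that mult_right_mono[of "\<bar>k\<bar>" 1 "norm e"] abs_leI[of k 1] k
        by (intro norm_triangle_le) auto
      then show "norm (v' (z + k *\<^sub>R e)) \<le> V"
        using V by (simp add: C_def)
    qed (use that in auto)
    then show ?thesis by simp
  qed
  have mv: "v \<in> borel_measurable borel" and mv': "v' \<in> borel_measurable borel"
    and m\<phi>: "\<phi> \<in> borel_measurable borel"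
    using v v' \<phi>c by (auto intro: borel_measurable_continuous_onI)
  have i0: "integrable lborel (\<lambda>z. \<phi> (z + k *\<^sub>R e) * v (z + h *\<^sub>R e))" if "\<bar>k\<bar> \<le> 1" for h k
  proof (rule integrable_continuous_compact_support[OF C])
    show "continuous_on UNIV (\<lambda>z. \<phi> (z + k *\<^sub>R e) * v (z + h *\<^sub>R e))"
      by (intro continuous_intros continuous_on_compose2[OF \<phi>c] continuous_on_compose2[OF v]) auto
    show "\<phi> (z + k *\<^sub>R e) * v (z + h *\<^sub>R e) = 0" if "z \<notin> C" for z
      using abs_le[of "-k" z] that \<open>\<bar>k\<bar> \<le> 1\<close> by simp
  qed
  \<comment> \<open>Translation invariance of Lebesgue measure. The literal
    \<open>0 *\<^sub>R e\<close> keeps the integrand in the shape of \<open>i0\<close> with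
    \<open>k = 0\<close>.\<close>
  have eq: "(\<integral>z. \<phi> (z + 0 *\<^sub>R e) * v (z + h *\<^sub>R e) \<partial>lborel)
      = (\<integral>z. \<phi> (z - h *\<^sub>R e) * v z \<partial>lborel)" for h
  proof -
    have "(\<integral>z. \<phi> (z - h *\<^sub>R e) * v z \<partial>lborel)
        = (\<integral>z. \<phi> (z - h *\<^sub>R e) * v z \<partial>distr lborel borel ((+) (h *\<^sub>R e)))"
      by (simp add: lborel_distr_plus)
    also have "\<dots> = (\<integral>z. \<phi> (z + 0 *\<^sub>R e) * v (z + h *\<^sub>R e) \<partial>lborel)"
      using mv m\<phi> by (subst integral_distr) (auto simp: add.commute)
    finally show ?thesis by simp
  qed
  have "((\<lambda>h. \<integral>z. \<phi> (z + 0 *\<^sub>R e) * v (z + h *\<^sub>R e) \<partial>lborel)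
      has_real_derivative (\<integral>z. \<phi> z * v' z \<partial>lborel)) (at 0)"
  proof (rule has_real_derivative_integral[where B = "\<lambda>z. \<bar>\<phi> z\<bar> * V"])
    show "integrable lborel (\<lambda>z. \<bar>\<phi> z\<bar> * V)"
      using abs_le[of 0] by (intro integrable_continuous_compact_support[OF C] continuous_intros \<phi>c) auto
    fix z :: 'a and h :: real assume h: "\<bar>h\<bar> < 1"
    show "\<bar>\<phi> (z + 0 *\<^sub>R e) * v (z + (0 + h) *\<^sub>R e) - \<phi> (z + 0 *\<^sub>R e) * v (z + 0 *\<^sub>R e)\<bar> \<le> \<bar>\<phi> z\<bar> * V * \<bar>h\<bar>"
    proof (cases "norm z \<le> \<bar>R\<bar>")
      case True
      then show ?thesis
        using mult_left_mono[OF vlip[OF h True], of "\<bar>\<phi> z\<bar>"]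
        by (simp add: abs_mult[symmetric] algebra_simps)
    next
      case False
      then show ?thesis using supp[of z] by simp
    qed
  qed (use i0[of 0] dv mv' m\<phi> in \<open>auto intro!: DERIV_cmult\<close>)
  \<comment> \<open>Now the shift falls on \<open>\<phi>\<close>, whose derivative exists only
    almost everywhere; the Lipschitz constant provides the majorant. The sign comes from shifting by
    -h.\<close>
  moreover have "((\<lambda>h. \<integral>z. \<phi> (z - h *\<^sub>R e) * v z \<partial>lborel)
      has_real_derivative (\<integral>z. - \<phi>' z * v z \<partial>lborel)) (at 0)"
  proof (rule has_real_derivative_integral[where B = "\<lambda>z. L * norm e * (indicator C z * \<bar>v z\<bar>)"])
    show "integrable lborel (\<lambda>z. \<phi> (z - (0 + h) *\<^sub>R e) * v z)" if "\<bar>h\<bar> < 1" for h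
      using i0[of "-h" 0] that by simp
    show "integrable lborel (\<lambda>z. L * norm e * (indicator C z * \<bar>v z\<bar>))"
      using integrable_abs[OF vint] by (simp add: abs_mult)
    show "AE z in lborel. ((\<lambda>r. \<phi> (z - r *\<^sub>R e) * v z) has_real_derivative - \<phi>' z * v z) (at 0)"
      using d\<phi>
    proof eventually_elim
      case (elim z)
      then have "((\<lambda>r. \<phi> (z + (-r) *\<^sub>R e)) has_real_derivative - \<phi>' z) (at 0)"
        using DERIV_mirror[of "\<lambda>r. \<phi> (z + r *\<^sub>R e)" "\<phi>' z" 0] by simp
      then show ?case by (auto intro!: derivative_eq_intros)
    qed
    fix z :: 'a and h :: real assume h: "\<bar>h\<bar> < 1"
    show "\<bar>\<phi> (z - (0 + h) *\<^sub>R e) * v z - \<phi> (z - 0 *\<^sub>R e) * v z\<bar>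
        \<le> L * norm e * (indicator C z * \<bar>v z\<bar>) * \<bar>h\<bar>"
    proof (cases "z \<in> C")
      case True
      have "\<bar>\<phi> (z - h *\<^sub>R e) - \<phi> z\<bar> \<le> L * (\<bar>h\<bar> * norm e)"
        using lipschitz_onD[OF lip, of "z - h *\<^sub>R e" z] by (simp add: dist_norm)
      from mult_right_mono[OF this, of "\<bar>v z\<bar>"] True show ?thesis
        by (simp add: abs_mult[symmetric] algebra_simps)
    next
      case False
      then show ?thesis using abs_le[of h z] abs_le[of 0 z] h by simp
    qed
  qed (use mv m\<phi>' in auto)
  ultimately have "(\<integral>z. \<phi> z * v' z \<partial>lborel) = (\<integral>z. - \<phi>' z * v z \<partial>lborel)"
    unfolding eq by (rule DERIV_unique)
  then show ?thesis by simp
qed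

section \<open>Radial weights on annuli\<close>

text \<open>On the annulus this is \<open>\<integral> \<rho>^(1 - p) d\<rho>\<close> from \<open>|z|\<close> to \<open>b\<close>; it is constant inside and 0 outside.\<close>

definition radial_primitive :: "real \<Rightarrow> real \<Rightarrow> real \<Rightarrow> 'a::real_normed_vector \<Rightarrow> real" where
  "radial_primitive a b p z = (min b (max a (norm z)) powr (2 - p) - b powr (2 - p)) / (p - 2)"

lemma radial_primitive_eq_0: "a < b \<Longrightarrow> b \<le> norm z \<Longrightarrow> radial_primitive a b p z = 0"
  by (simp add: radial_primitive_def max_def)

lemma radial_primitive_nonneg:
  assumes "0 < a" "a < b" "2 < p"
  shows "0 \<le> radial_primitive a b p z"
  using assms powr_mono2'[of "2 - p" "min b (max a (norm z))" b]
  by (auto simp: radial_primitive_def intro!: divide_nonneg_pos)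

lemma radial_primitive_pos:
  assumes "0 < a" "a < b" "2 < p" "norm z \<le> a"
  shows "0 < radial_primitive a b p z"
  using assms powr_less_mono2_neg[of "2 - p" a b]
  by (auto simp: radial_primitive_def max_def)

lemma powr_primitive_has_derivative:
  fixes r p :: real
  assumes "0 < r" "p \<noteq> 2"
  shows "((\<lambda>r. (r powr (2 - p) - c) / (p - 2)) has_real_derivative - (r powr (1 - p))) (at r)"
proof -
  have "((\<lambda>r. (r powr (2 - p) - c) / (p - 2)) has_real_derivative
      ((2 - p) * r powr (2 - p - 1) - 0) / (p - 2)) (at r)"
    using assms by (intro DERIV_cdivide DERIV_diff DERIV_const has_real_derivative_powr)
  moreover have "((2 - p) * r powr (2 - p - 1) - 0) / (p - 2) = - (r powr (1 - p))"
    using assms by (simp add: divide_eq_eq algebra_simps)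
  ultimately show ?thesis by simp
qed

text \<open>Clamping the norm to [a, b] is 1-Lipschitz, and the derivative -r^(1-p) of the profile
  is largest in modulus at r = a since 1 - p < 0.\<close>

lemma radial_primitive_lipschitz:
  assumes "0 < a" "a < b" "2 < p"
  shows "(a powr (1 - p))-lipschitz_on UNIV (radial_primitive a b p :: 'a::real_normed_vector \<Rightarrow> real)"
proof (rule lipschitz_onI)
  fix y z :: 'a
  let ?c = "\<lambda>z::'a. min b (max a (norm z))"
  let ?f = "\<lambda>r. (r powr (2 - p) - b powr (2 - p)) / (p - 2)"
  have "norm (?f (?c y) - ?f (?c z)) \<le> a powr (1 - p) * norm (?c y - ?c z)"
  proof (rule field_differentiable_bound[where S = "{a..b}" and f' = "\<lambda>r. - (r powr (1 - p))"])
    fix r assume r: "r \<in> {a..b}"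
    have "(?f has_field_derivative - (r powr (1 - p))) (at r)"
      using r assms by (intro powr_primitive_has_derivative) auto
    then show "(?f has_field_derivative - (r powr (1 - p))) (at r within {a..b})"
      by (rule has_field_derivative_at_within)
    show "norm (- (r powr (1 - p))) \<le> a powr (1 - p)"
      using r assms by (auto intro!: powr_mono2')
  qed (use assms in auto)
  also have "norm (?c y - ?c z) \<le> norm (y - z)"
    using norm_triangle_ineq3[of y z] by (auto simp: min_def max_def)
  finally show "dist (radial_primitive a b p y) (radial_primitive a b p z) \<le> a powr (1 - p) * dist y z"
    by (simp add: radial_primitive_def dist_norm mult_left_mono)
qed auto

text \<open>The primitive is constant on the inner ball and zero outside the outer one. In between,
  the chain rule gives -|z|^(1-p) times the derivative (z . e)/|z| of the norm. The excluded spheres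
  are where these formulas meet.\<close>

lemma radial_primitive_has_derivative:
  fixes z e :: "'a::real_inner"
  assumes "0 < a" "a < b" and p: "2 < p" and ne: "norm z \<noteq> a" "norm z \<noteq> b"
  shows "((\<lambda>h. radial_primitive a b p (z + h *\<^sub>R e)) has_real_derivative
    - (indicator (ball 0 b - ball 0 a) z * ((z \<bullet> e) / norm z powr p))) (at 0)"
proof -
  let ?n = "\<lambda>h. norm (z + h *\<^sub>R e)"
  have lim: "(?n \<longlongrightarrow> norm z) (at 0)"
    by (auto intro!: tendsto_eq_intros)
  \<comment> \<open>By continuity of the norm along the line, strict inequalities for |z| persist
    for small h. The filter \<open>nhds 0\<close>, which includes h = 0, is what
    \<open>DERIV_cong_ev\<close> requires.\<close>
  have near: "eventually (\<lambda>h. P (?n h)) (nhds 0)" if "eventually P (nhds (norm z))" for P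
  proof -
    have "filterlim ?n (nhds (norm z)) (nhds 0)"
      using lim tendsto_at_iff_tendsto_nhds[of ?n 0] by simp
    then show ?thesis using that by (simp add: filterlim_iff)
  qed
  consider "norm z < a" | "b < norm z" | "a < norm z" "norm z < b" using ne by linarith
  then show ?thesis
  proof cases
    case 1
    have "eventually (\<lambda>h. ?n h < a) (nhds 0)"
      using 1 by (intro near) (auto intro: eventually_nhds_in_open[of "{..<a}", simplified])
    then have "eventually (\<lambda>h. radial_primitive a b p (z + h *\<^sub>R e) = radial_primitive a b p z) (nhds 0)"
      by eventually_elim (use 1 in \<open>simp add: radial_primitive_def max_def\<close>)
    then have "((\<lambda>h. radial_primitive a b p (z + h *\<^sub>R e)) has_real_derivative 0) (at 0)"
      by (subst DERIV_cong_ev[OF refl _ refl]) auto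
    then show ?thesis using 1 by simp
  next
    case 2
    have "eventually (\<lambda>h. b < ?n h) (nhds 0)"
      using 2 by (intro near) (auto intro: eventually_nhds_in_open[of "{b<..}", simplified])
    then have "eventually (\<lambda>h. radial_primitive a b p (z + h *\<^sub>R e) = 0) (nhds 0)"
      by eventually_elim (use assms in \<open>simp add: radial_primitive_eq_0\<close>)
    then have "((\<lambda>h. radial_primitive a b p (z + h *\<^sub>R e)) has_real_derivative 0) (at 0)"
      by (subst DERIV_cong_ev[OF refl _ refl]) auto
    then show ?thesis using 2 by simp
  next
    case 3
    then have z: "z \<noteq> 0" using assms by auto
    have "eventually (\<lambda>h. a < ?n h \<and> ?n h < b) (nhds 0)"
      using 3 by (intro near) (auto intro: eventually_nhds_in_open[of "{a<..<b}", simplified])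
    then have ev: "eventually (\<lambda>h. radial_primitive a b p (z + h *\<^sub>R e)
        = (?n h powr (2 - p) - b powr (2 - p)) / (p - 2)) (nhds 0)"
      by eventually_elim (simp add: radial_primitive_def)
    have "(?n has_derivative (\<lambda>h. (z \<bullet> (h *\<^sub>R e)) / norm z)) (at 0)"
      by (rule has_derivative_eq_rhs[OF has_derivative_compose[where g = norm, OF _ has_derivative_norm]])
        (use z in \<open>auto intro!: derivative_eq_intros simp: sgn_div_norm inner_commute divide_inverse\<close>)
    then have n': "(?n has_real_derivative (z \<bullet> e) / norm z) (at 0)"
      by (rule has_derivative_imp_has_field_derivative) simp
    have "((\<lambda>h. (?n h powr (2 - p) - b powr (2 - p)) / (p - 2)) has_real_derivative
       - ((z \<bullet> e) / norm z powr p)) (at 0)"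
    proof -
      have "((\<lambda>h. (?n h powr (2 - p) - b powr (2 - p)) / (p - 2)) has_real_derivative
          - (norm z powr (1 - p)) * ((z \<bullet> e) / norm z)) (at 0)"
        by (rule DERIV_chain2[where g = ?n, OF _ n'])
          (use z p in \<open>auto intro: powr_primitive_has_derivative\<close>)
      moreover have "norm z powr (1 - p) = norm z / norm z powr p"
        using z by (simp add: powr_diff)
      ultimately show ?thesis using z by simp
    qed
    then have "((\<lambda>h. radial_primitive a b p (z + h *\<^sub>R e)) has_real_derivative
       - ((z \<bullet> e) / norm z powr p)) (at 0)"
      by (subst DERIV_cong_ev[OF refl ev refl])
    then show ?thesis using 3 by simp
  qed
qed

lemma AE_norm_neq:
  "AE z in lborel. norm (z :: 'a::euclidean_space) \<noteq> r"
proof -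
  have "negligible (sphere (0::'a) r)" by (rule negligible_sphere)
  then have "sphere (0::'a) r \<in> null_sets lborel"
    by (simp add: negligible_iff_null_sets null_sets_completion_iff)
  from AE_not_in[OF this] show ?thesis by eventually_elim simp
qed

text \<open>The half-open annulus lies in a compact set that avoids the origin because a > 0, so the
  integrand is continuous there.\<close>

lemma integrable_annulus:
  fixes f :: "'a::euclidean_space \<Rightarrow> real"
  assumes "0 < a" "continuous_on UNIV f"
  shows "set_integrable lborel (ball 0 b - ball 0 a) (\<lambda>z. f z / norm z powr p)"
proof (rule set_integrable_subset)
  have "compact (cball (0::'a) b - ball 0 a)" by (simp add: compact_diff)
  then show "set_integrable lborel (cball (0::'a) b - ball 0 a) (\<lambda>z. f z / norm z powr p)"
    unfolding set_integrable_def using assms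
    by (intro borel_integrable_compact)
      (auto intro!: continuous_intros continuous_on_subset[OF assms(2)])
qed auto

section \<open>Differentiating annulus integrals in the dilation parameter\<close>

lemma annulus_integral_has_derivative:
  fixes u :: "real^'n \<Rightarrow> real"
  assumes dg: "\<And>x. (u has_derivative (\<lambda>h. g x \<bullet> h)) (at x)"
    and dH: "\<And>x. (g has_derivative (\<lambda>h. H x *v h)) (at x)"
    and H: "continuous_on UNIV H"
    and ab: "0 < a" "a < b" and p: "2 < p"
  shows "((\<lambda>t. LINT z:ball 0 b - ball 0 a|lborel. u (x + t *\<^sub>R z) / norm z powr p) has_real_derivative
    t * (\<integral>z. radial_primitive a b p z * trace (H (x + t *\<^sub>R z)) \<partial>lborel)) (at t)"
proof -
  let ?A = "ball 0 b - ball (0::real^'n) a"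
  have u: "continuous_on UNIV u" and g: "continuous_on UNIV g"
    using has_derivative_continuous_on[OF dg] has_derivative_continuous_on[OF dH] by auto
  \<comment> \<open>\<open>K\<close> contains every x + rz with |r - t| at most 1 and |z| < b, so a
    bound \<open>G\<close> for the gradient on \<open>K\<close> dominates all difference
    quotients.\<close>
  define K where "K = cball x ((\<bar>t\<bar> + 1) * b)"
  obtain G where G: "\<And>y. y \<in> K \<Longrightarrow> norm (g y) \<le> G"
    using compact_imp_bounded[OF compact_continuous_image[OF continuous_on_subset[OF g], of K]]
    unfolding bounded_iff K_def by (auto simp del: mem_cball)
  have du: "((\<lambda>r. u (x + r *\<^sub>R z)) has_real_derivative g (x + r *\<^sub>R z) \<bullet> z) (at r)" for r z
  proof -
    have "((\<lambda>r. u (x + r *\<^sub>R z)) has_derivative (\<lambda>h. g (x + r *\<^sub>R z) \<bullet> (h *\<^sub>R z))) (at r)"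
      by (rule has_derivative_compose[OF _ dg]) (auto intro!: derivative_eq_intros)
    then show ?thesis
      by (rule has_derivative_imp_has_field_derivative) simp
  qed
  \<comment> \<open>Absorbing the indicator into the weight turns integrals over the annulus into
    integrals over the whole space.\<close>
  define w :: "real^'n \<Rightarrow> real" where "w z = indicator ?A z / norm z powr p" for z
  have w0: "0 \<le> w z" for z by (simp add: w_def)
  have wA: "norm z < b" if "w z \<noteq> 0" for z
    using that by (auto simp: w_def indicator_def split: if_splits)
  have wint: "integrable lborel (\<lambda>z. w z * f z)" if "continuous_on UNIV f" for f
    using integrable_annulus[OF ab(1) that, of b p] by (simp add: set_integrable_def w_def)
  have "((\<lambda>r. \<integral>z. w z * u (x + r *\<^sub>R z) \<partial>lborel) has_real_derivative
      (\<integral>z. w z * (g (x + t *\<^sub>R z) \<bullet> z) \<partial>lborel)) (at t)"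
  proof (rule has_real_derivative_integral[where B = "\<lambda>z. w z * (G * b)"])
    fix h :: real assume h: "\<bar>h\<bar> < 1"
    show "integrable lborel (\<lambda>z. w z * u (x + (t + h) *\<^sub>R z))"
      by (intro wint continuous_on_compose2[OF u] continuous_intros) auto
    fix z
    show "\<bar>w z * u (x + (t + h) *\<^sub>R z) - w z * u (x + t *\<^sub>R z)\<bar> \<le> w z * (G * b) * \<bar>h\<bar>"
    proof (cases "w z = 0")
      case False
      have "norm (u (x + (t + h) *\<^sub>R z) - u (x + t *\<^sub>R z)) \<le> (G * b) * norm ((t + h) - t)"
      proof (rule field_differentiable_bound[where S = "{t - 1..t + 1}" and f' = "\<lambda>r. g (x + r *\<^sub>R z) \<bullet> z"])
        fix r assume r: "r \<in> {t - 1..t + 1}"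
        show "((\<lambda>r. u (x + r *\<^sub>R z)) has_field_derivative g (x + r *\<^sub>R z) \<bullet> z) (at r within {t - 1..t + 1})"
          using du by (rule has_field_derivative_at_within)
        have "\<bar>r\<bar> * norm z \<le> (\<bar>t\<bar> + 1) * b"
          using r wA[OF False] by (intro mult_mono) auto
        then have "norm (g (x + r *\<^sub>R z)) \<le> G"
          by (intro G) (simp add: K_def dist_norm)
        then have "norm (g (x + r *\<^sub>R z)) * norm z \<le> G * b"
          using wA[OF False] by (intro mult_mono) (auto intro: order_trans[OF norm_ge_zero])
        then show "norm (g (x + r *\<^sub>R z) \<bullet> z) \<le> G * b"
          using Cauchy_Schwarz_ineq2[of "g (x + r *\<^sub>R z)" z] by simp
      qed (use h in auto)
      from mult_left_mono[OF this w0[of z]] w0[of z] show ?thesis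
        unfolding right_diff_distrib[symmetric] abs_mult by (simp add: mult.assoc)
    qed simp
  next
    show "(\<lambda>z. w z * (g (x + t *\<^sub>R z) \<bullet> z)) \<in> borel_measurable lborel"
      by (intro borel_measurable_integrable wint continuous_intros continuous_on_compose2[OF g]) auto
  next
    show "integrable lborel (\<lambda>z. w z * (G * b))"
      by (rule wint) auto
  qed (auto intro!: DERIV_cmult du)
  moreover have "(\<integral>z. w z * (g (x + t *\<^sub>R z) \<bullet> z) \<partial>lborel)
      = t * (\<integral>z. radial_primitive a b p z * trace (H (x + t *\<^sub>R z)) \<partial>lborel)"
  proof -
    \<comment> \<open>\<open>v i\<close> is the i-th gradient component along the dilation and
      \<open>v' i\<close> its i-th partial derivative in z; the factor t comes from the chain rule.
      Summing over i produces t times the trace of the Hessian.\<close>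
    define v where "v i z = g (x + t *\<^sub>R z) $ i" for i z
    define v' where "v' i z = t * H (x + t *\<^sub>R z) $ i $ i" for i z
    have cv: "continuous_on UNIV (v i)" for i
      unfolding v_def by (intro continuous_intros continuous_on_compose2[OF g]) auto
    have cv': "continuous_on UNIV (v' i)" for i
      unfolding v'_def by (intro continuous_intros continuous_on_compose2[OF H]) auto
    have \<phi>c: "continuous_on UNIV (radial_primitive a b p :: real^'n \<Rightarrow> real)"
      using radial_primitive_lipschitz[OF ab p] by (rule lipschitz_on_continuous_on)
    have int: "integrable lborel (\<lambda>z. radial_primitive a b p z * v' i z)" for i
      by (rule integrable_continuous_compact_support[of "cball 0 b"])
        (auto intro!: continuous_intros \<phi>c cv' simp: radial_primitive_eq_0 ab)
    \<comment> \<open>No boundary terms arise: the primitive is continuous across both spheres and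
      has compact support. Its gradient is \<open>- w z *\<^sub>R z\<close> off the two null
      spheres.\<close>
    have ibp: "(\<integral>z. radial_primitive a b p z * v' i z \<partial>lborel) = (\<integral>z. w z * (z $ i * v i z) \<partial>lborel)" for i
    proof -
      have "(\<integral>z. radial_primitive a b p z * v' i z \<partial>lborel)
        = - (\<integral>z. - (indicator ?A z * ((z \<bullet> axis i 1) / norm z powr p)) * v i z \<partial>lborel)"
      proof (rule integral_by_parts_direction[where e = "axis i 1", OF radial_primitive_lipschitz[OF ab p], of b])
        show "AE z in lborel. ((\<lambda>h. radial_primitive a b p (z + h *\<^sub>R axis i 1)) has_real_derivative
            - (indicator ?A z * ((z \<bullet> axis i 1) / norm z powr p))) (at 0)"
          using AE_norm_neq[of a] AE_norm_neq[of b]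
          by eventually_elim (rule radial_primitive_has_derivative[OF ab p])
        fix z :: "real^'n"
        have "((\<lambda>h. x + t *\<^sub>R (z + h *\<^sub>R axis i 1)) has_derivative (\<lambda>h. t *\<^sub>R h *\<^sub>R axis i 1)) (at 0)"
          by (auto intro!: derivative_eq_intros)
        from has_derivative_compose[OF this, of g "\<lambda>h. H (x + t *\<^sub>R z) *v h"] dH[of "x + t *\<^sub>R z"]
        have "((\<lambda>h. g (x + t *\<^sub>R (z + h *\<^sub>R axis i 1))) has_derivative
            (\<lambda>h. H (x + t *\<^sub>R z) *v (t *\<^sub>R h *\<^sub>R axis i 1))) (at 0)"
          by simp
        then have "((\<lambda>h. v i (z + h *\<^sub>R axis i 1)) has_derivative
            (\<lambda>h. (H (x + t *\<^sub>R z) *v (t *\<^sub>R h *\<^sub>R axis i 1)) $ i)) (at 0)"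
          unfolding v_def by (rule bounded_linear.has_derivative[OF bounded_linear_vec_nth])
        moreover have "(H (x + t *\<^sub>R z) *v (t *\<^sub>R h *\<^sub>R axis i 1)) $ i = v' i z * h" for h
          by (simp add: v'_def matrix_vector_mult_def axis_def if_distrib mult_ac cong: if_cong)
        ultimately show "((\<lambda>h. v i (z + h *\<^sub>R axis i 1)) has_real_derivative v' i z) (at 0)"
          by (intro has_derivative_imp_has_field_derivative) (auto simp: mult.commute)
        have "integrable lborel (\<lambda>z. w z * (z \<bullet> axis i 1))"
          by (intro wint continuous_intros)
        from borel_measurable_integrable[OF this]
        show "(\<lambda>z. - (indicator ?A z * ((z \<bullet> axis i 1) / norm z powr p))) \<in> borel_measurable borel"
          by (simp add: w_def)
      qed (use ab cv cv' in \<open>auto simp: radial_primitive_eq_0\<close>)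
      then show ?thesis by (simp add: w_def inner_axis mult_ac)
    qed
    have "(\<integral>z. w z * (g (x + t *\<^sub>R z) \<bullet> z) \<partial>lborel) = (\<integral>z. (\<Sum>i\<in>UNIV. w z * (z $ i * v i z)) \<partial>lborel)"
      by (simp add: inner_vec_def v_def sum_distrib_left mult_ac)
    also have "\<dots> = (\<Sum>i\<in>UNIV. \<integral>z. w z * (z $ i * v i z) \<partial>lborel)"
      by (intro Bochner_Integration.integral_sum wint continuous_intros cv)
    also have "\<dots> = (\<Sum>i\<in>UNIV. \<integral>z. radial_primitive a b p z * v' i z \<partial>lborel)"
      by (simp add: ibp)
    also have "\<dots> = (\<integral>z. (\<Sum>i\<in>UNIV. radial_primitive a b p z * v' i z) \<partial>lborel)"
      by (intro Bochner_Integration.integral_sum[symmetric] int)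
    also have "\<dots> = (\<integral>z. t * (radial_primitive a b p z * trace (H (x + t *\<^sub>R z))) \<partial>lborel)"
      by (simp add: v'_def trace_def sum_distrib_left mult_ac)
    finally show ?thesis by simp
  qed
  ultimately show ?thesis
    by (simp add: set_lebesgue_integral_def w_def)
qed

text \<open>Substitution by the dilation with factor r: the Jacobian contributes r to the dimension,
  the weight contributes r^(-p). For p = N + 2s the total factor is r^(-2s).\<close>

lemma integral_annulus_scaleR:
  fixes f :: "'a::euclidean_space \<Rightarrow> real"
  assumes "0 < r" "0 < a" "continuous_on UNIV f"
  shows "(LINT z:ball 0 (r * b) - ball 0 (r * a)|lborel. f z / norm z powr p)
    = r powr (real DIM('a) - p) * (LINT z:ball 0 b - ball 0 a|lborel. f (r *\<^sub>R z) / norm z powr p)"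
proof -
  let ?F = "\<lambda>z. indicator (ball 0 (r * b) - ball (0::'a) (r * a)) z *\<^sub>R (f z / norm z powr p)"
  have "integrable lborel ?F"
    using integrable_annulus[of "r * a" f "r * b" p] assms by (simp add: set_integrable_def)
  then have meas [measurable]: "?F \<in> borel_measurable borel"
    using borel_measurable_integrable by fastforce
  have F: "?F (r *\<^sub>R z) = r powr - p
      * (indicator (ball 0 b - ball 0 a) z *\<^sub>R (f (r *\<^sub>R z) / norm z powr p))" for z
    using assms by (auto simp: indicator_def powr_mult powr_minus field_simps)
  have "integral\<^sup>L lborel ?F
      = integral\<^sup>L (density (distr lborel borel (\<lambda>z. 0 + r *\<^sub>R z)) (\<lambda>_. ennreal (\<bar>r\<bar> ^ DIM('a)))) ?F"
    using lborel_affine[of r "0::'a"] assms by simp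
  also have "\<dots> = (\<integral>z. \<bar>r\<bar> ^ DIM('a) *\<^sub>R ?F z \<partial>distr lborel borel (\<lambda>z. 0 + r *\<^sub>R z))"
    by (rule integral_density) (use meas in auto)
  also have "\<dots> = (\<integral>z. \<bar>r\<bar> ^ DIM('a) *\<^sub>R ?F (0 + r *\<^sub>R z) \<partial>lborel)"
    by (rule integral_distr) measurable
  also have "\<dots> = \<bar>r\<bar> ^ DIM('a) * (\<integral>z. ?F (r *\<^sub>R z) \<partial>lborel)"
    by (simp only: add_0 real_scaleR_def integral_mult_right_zero)
  also have "\<dots> = \<bar>r\<bar> ^ DIM('a) * r powr - p
      * (LINT z:ball 0 b - ball 0 a|lborel. f (r *\<^sub>R z) / norm z powr p)"
    unfolding F by (simp only: set_lebesgue_integral_def integral_mult_right_zero mult.assoc)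
  also have "\<bar>r\<bar> ^ DIM('a) * r powr - p = r powr (real DIM('a) - p)"
    using assms by (simp add: powr_realpow[symmetric] powr_add[symmetric])
  finally show ?thesis
    by (simp add: set_lebesgue_integral_def)
qed

section \<open>Harmonic functions are s-harmonic\<close>

lemma classical_harmonic_imp_frac_lap_at:
  fixes u :: "real^'n \<Rightarrow> real"
  assumes "classical_harmonic u" and p: "2 < real CARD('n) + 2 * s"
  shows "frac_lap_at s u x 0"
proof -
  define p where "p = real CARD('n) + 2 * s"
  from assms(1) obtain g H where dg: "\<And>x. (u has_derivative (\<lambda>h. g x \<bullet> h)) (at x)"
    and dH: "\<And>x. (g has_derivative (\<lambda>h. H x *v h)) (at x)"
    and H: "continuous_on UNIV H" and tr: "\<And>x. trace (H x) = 0"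
    unfolding classical_harmonic_def trace_def by blast
  have u: "continuous_on UNIV u"
    using has_derivative_continuous_on[OF dg] by auto
  have int: "set_integrable lborel (ball 0 b - ball 0 a) (\<lambda>z. u (x + t *\<^sub>R z) / norm z powr p)"
    if "0 < a" for a b t
    using that by (intro integrable_annulus continuous_intros continuous_on_compose2[OF u]) auto
  have zero: "(LINT z:ball 0 (1/\<epsilon>) - ball 0 \<epsilon>|lborel. (u x - u (x + z)) / norm z powr p) = 0"
    if "0 < \<epsilon>" "\<epsilon> < 1" for \<epsilon>
  proof -
    let ?K = "\<lambda>t. LINT z:ball 0 (1/\<epsilon>) - ball 0 \<epsilon>|lborel. u (x + t *\<^sub>R z) / norm z powr p"
    have "\<epsilon> < 1 / \<epsilon>"
      using that mult_strict_mono[of \<epsilon> 1 \<epsilon> 1] by (simp add: field_simps)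
    then have "(?K has_real_derivative 0) (at t)" for t
      using annulus_integral_has_derivative[OF dg dH H that(1), of "1/\<epsilon>" p x t] p
      by (simp add: tr p_def)
    \<comment> \<open>At t = 0 the numerator is the constant u(x), at t = 1 it is u(x + z); the
      truncated integral is the difference of these two values.\<close>
    then have "?K 0 = ?K 1"
      by (intro DERIV_isconst_all) auto
    then show ?thesis
      using set_integral_diff(2)[OF int[of \<epsilon> "1/\<epsilon>" 0] int[of \<epsilon> "1/\<epsilon>" 1]] that
      by (simp add: diff_divide_distrib)
  qed
  have ev: "\<forall>\<^sub>F \<epsilon> in at_right 0. 0 < \<epsilon> \<and> \<epsilon> < (1::real)"
    using eventually_at_right_less[of "0::real"] eventually_at_right_field[of "\<lambda>\<epsilon>. \<epsilon> < 1" "0::real"]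
    by (auto intro!: eventually_conj exI[of _ 1])
  show ?thesis
    unfolding frac_lap_at_def p_def[symmetric]
  proof
    show "\<forall>\<^sub>F \<epsilon> in at_right 0. set_integrable lborel (ball 0 (1/\<epsilon>) - ball 0 \<epsilon>)
         (\<lambda>z. (u x - u (x + z)) / norm z powr p)"
      using ev
    proof eventually_elim
      case (elim \<epsilon>)
      then show ?case
        by (intro integrable_annulus continuous_intros continuous_on_compose2[OF u]) auto
    qed
    \<comment> \<open>The truncated integrals are exactly 0 once \<epsilon> < 1, so the limit is
      that of an eventually constant function.\<close>
    show "((\<lambda>\<epsilon>. c_const CARD('n) s * (LINT z:ball 0 (1/\<epsilon>) - ball 0 \<epsilon>|lborel.
        (u x - u (x + z)) / norm z powr p)) \<longlongrightarrow> 0) (at_right 0)"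
      by (rule tendsto_eventually) (use ev in \<open>eventually_elim, simp add: zero\<close>)
  qed
qed

section \<open>Polynomials\<close>

lemma hom_poly_imp_real_polynomial_function:
  assumes "hom_poly m u"
  shows "real_polynomial_function u"
proof -
  obtain b where u: "u = (\<lambda>x. \<Sum>\<alpha>\<in>multi_indices m. b \<alpha> * (\<Prod>i\<in>UNIV. (x $ i) ^ \<alpha> i))"
    using assms unfolding hom_poly_def by blast
  show ?thesis
  \<comment> \<open>A sum over an infinite index set is 0 by convention, hence also polynomial; the
    split avoids proving that \<open>multi_indices m\<close> is finite.\<close>
  proof (cases "finite (multi_indices m :: ('a \<Rightarrow> nat) set)")
    case True
    then show ?thesis
      unfolding u by (intro real_polynomial_function_sum real_polynomial_function.intros(2,4)
          real_polynomial_function_prod real_polynomial_function_power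
          real_polynomial_function.intros(1)[OF bounded_linear_vec_nth]) auto
  qed (auto simp: u)
qed

text \<open>The product rule keeps the gradient components polynomial, so the lemma can be applied
  again to each of them to obtain the Hessian.\<close>

lemma real_polynomial_function_gradient:
  fixes u :: "real^'n \<Rightarrow> real"
  assumes "real_polynomial_function u"
  shows "\<exists>g. (\<forall>i. real_polynomial_function (\<lambda>x. g x $ i)) \<and> (\<forall>x. (u has_derivative (\<lambda>h. g x \<bullet> h)) (at x))"
  using assms
proof induction
  case (linear f)
  \<comment> \<open>The vector \<open>adjoint f 1\<close> represents the linear functional
    \<open>f\<close> as an inner product.\<close>
  have "adjoint f 1 \<bullet> h = f h" for h
    using adjoint_works[OF bounded_linear.linear[OF linear], of h 1] by (simp add: inner_commute)
  then show ?case
    using linear by (intro exI[of _ "\<lambda>_. adjoint f 1"]) (auto simp: bounded_linear_imp_has_derivative)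
next
  case (const c)
  then show ?case by (intro exI[of _ "\<lambda>_. 0"]) auto
next
  case (add f1 f2)
  then obtain g1 g2 where
    "\<And>i. real_polynomial_function (\<lambda>x. g1 x $ i)" "\<And>i. real_polynomial_function (\<lambda>x. g2 x $ i)"
    "\<And>x. (f1 has_derivative (\<lambda>h. g1 x \<bullet> h)) (at x)" "\<And>x. (f2 has_derivative (\<lambda>h. g2 x \<bullet> h)) (at x)"
    by blast
  then show ?case
    by (intro exI[of _ "\<lambda>x. g1 x + g2 x"]) (auto simp: inner_add_left intro!: derivative_intros)
next
  case (mult f1 f2)
  then obtain g1 g2 where g:
    "\<And>i. real_polynomial_function (\<lambda>x. g1 x $ i)" "\<And>i. real_polynomial_function (\<lambda>x. g2 x $ i)"
    "\<And>x. (f1 has_derivative (\<lambda>h. g1 x \<bullet> h)) (at x)" "\<And>x. (f2 has_derivative (\<lambda>h. g2 x \<bullet> h)) (at x)"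
    by blast
  show ?case
  proof (intro exI[of _ "\<lambda>x. f1 x *\<^sub>R g2 x + f2 x *\<^sub>R g1 x"] conjI allI)
    show "real_polynomial_function (\<lambda>x. (f1 x *\<^sub>R g2 x + f2 x *\<^sub>R g1 x) $ i)" for i
      using mult.hyps g
      by (simp only: vector_add_component vector_scaleR_component real_scaleR_def)
        (intro real_polynomial_function.intros(3,4))
    show "((\<lambda>x. f1 x * f2 x) has_derivative (\<lambda>h. (f1 x *\<^sub>R g2 x + f2 x *\<^sub>R g1 x) \<bullet> h)) (at x)" for x
      using has_derivative_mult[OF g(3,4)[of x]]
      by (simp add: inner_add_left algebra_simps)
  qed
qed

lemma real_polynomial_function_hessian:
  fixes u :: "real^'n \<Rightarrow> real"
  assumes "real_polynomial_function u"
  obtains g H where "\<And>x. (u has_derivative (\<lambda>h. g x \<bullet> h)) (at x)"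
    "\<And>x. (g has_derivative (\<lambda>h. H x *v h)) (at x)" "continuous_on UNIV H"
proof -
  obtain g where g: "\<And>i. real_polynomial_function (\<lambda>x. g x $ i)"
    "\<And>x. (u has_derivative (\<lambda>h. g x \<bullet> h)) (at x)"
    using real_polynomial_function_gradient[OF assms] by blast
  obtain G where G: "\<And>i j. real_polynomial_function (\<lambda>x. G i x $ j)"
    "\<And>i x. ((\<lambda>x. g x $ i) has_derivative (\<lambda>h. G i x \<bullet> h)) (at x)"
    using real_polynomial_function_gradient[OF g(1)] by metis
  show thesis
  proof
    show "(g has_derivative (\<lambda>h. (\<chi> i. G i x) *v h)) (at x)" for x
      using G(2) unfolding has_derivative_componentwise_within[of g]
      by (auto simp: Basis_vec_def inner_axis matrix_mult_dot)
    have "continuous_on UNIV (\<lambda>x. G i x $ j)" for i j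
      using G(1) by (simp add: real_polynomial_function_eq continuous_on_polymonial_function)
    then have "continuous_on UNIV (\<lambda>x. \<chi> j. G i x $ j)" for i
      by (rule continuous_on_vec_lambda)
    then show "continuous_on UNIV (\<lambda>x. \<chi> i. G i x)"
      by (intro continuous_on_vec_lambda) simp
  qed (fact g(2))
qed

text \<open>Prepares integration over z coefficient by coefficient: continuity makes each
  coefficient integrable on annuli, and the degree bound uniform in z leaves a fixed finite
  sum.\<close>

lemma real_polynomial_function_line:
  fixes u :: "'a::real_normed_vector \<Rightarrow> real"
  assumes "real_polynomial_function u"
  shows "\<exists>P n. (\<forall>k. continuous_on UNIV (\<lambda>z. coeff (P z) k)) \<and> (\<forall>z. degree (P z) \<le> n)
    \<and> (\<forall>t z. u (x + t *\<^sub>R z) = poly (P z) t)"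
  using assms
proof induction
  case (linear f)
  then have "continuous_on UNIV (\<lambda>z. coeff [:f x, f z:] k)" for k
    by (cases k; cases "k - 1") (auto simp: linear_continuous_on)
  moreover have "f (x + t *\<^sub>R z) = poly [:f x, f z:] t" for t z
    using linear by (simp add: linear_simps)
  ultimately show ?case
    by (intro exI[of _ "\<lambda>z. [:f x, f z:]"] exI[of _ 1]) auto
next
  case (const c)
  then show ?case by (intro exI[of _ "\<lambda>z. [:c:]"] exI[of _ 0]) auto
next
  case (add f1 f2)
  then obtain P1 n1 P2 n2 where P:
    "\<And>k. continuous_on UNIV (\<lambda>z. coeff (P1 z) k)" "\<And>z. degree (P1 z) \<le> n1"
    "\<And>t z. f1 (x + t *\<^sub>R z) = poly (P1 z) t"
    "\<And>k. continuous_on UNIV (\<lambda>z. coeff (P2 z) k)" "\<And>z. degree (P2 z) \<le> n2"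
    "\<And>t z. f2 (x + t *\<^sub>R z) = poly (P2 z) t"
    by blast
  have "degree (P1 z + P2 z) \<le> max n1 n2" for z
    using P(2,5)[of z] by (intro degree_add_le) auto
  then show ?case
    using P by (intro exI[of _ "\<lambda>z. P1 z + P2 z"] exI[of _ "max n1 n2"]) (auto intro!: continuous_intros)
next
  case (mult f1 f2)
  then obtain P1 n1 P2 n2 where P:
    "\<And>k. continuous_on UNIV (\<lambda>z. coeff (P1 z) k)" "\<And>z. degree (P1 z) \<le> n1"
    "\<And>t z. f1 (x + t *\<^sub>R z) = poly (P1 z) t"
    "\<And>k. continuous_on UNIV (\<lambda>z. coeff (P2 z) k)" "\<And>z. degree (P2 z) \<le> n2"
    "\<And>t z. f2 (x + t *\<^sub>R z) = poly (P2 z) t"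
    by blast
  have "degree (P1 z * P2 z) \<le> n1 + n2" for z
    using P(2,5)[of z] degree_mult_le[of "P1 z" "P2 z"] by linarith
  then show ?case
    using P by (intro exI[of _ "\<lambda>z. P1 z * P2 z"] exI[of _ "n1 + n2"])
      (auto simp: coeff_mult intro!: continuous_intros)
qed

lemma annulus_integral_eq_poly:
  fixes u :: "'a::euclidean_space \<Rightarrow> real"
  assumes "real_polynomial_function u" "0 < a"
  obtains P where "\<And>t. (LINT z:ball 0 b - ball 0 a|lborel. u (x + t *\<^sub>R z) / norm z powr p) = poly P t"
proof -
  obtain P n where P: "\<And>k. continuous_on UNIV (\<lambda>z. coeff (P z) k)" "\<And>z. degree (P z) \<le> n"
    "\<And>t z. u (x + t *\<^sub>R z) = poly (P z) t"
    using real_polynomial_function_line[OF assms(1), of x] by blast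
  let ?A = "ball 0 b - ball (0::'a) a"
  define c where "c k = (LINT z:?A|lborel. coeff (P z) k / norm z powr p)" for k
  have "(LINT z:?A|lborel. u (x + t *\<^sub>R z) / norm z powr p) = poly (\<Sum>k\<le>n. monom (c k) k) t" for t
  proof -
    \<comment> \<open>Padding with zero coefficients up to n makes the index range independent of z,
      so sum and integral can be interchanged.\<close>
    have "u (x + t *\<^sub>R z) = (\<Sum>k\<le>n. coeff (P z) k * t ^ k)" for z
      unfolding P(3) poly_altdef using P(2)[of z]
      by (intro sum.mono_neutral_left) (auto simp: coeff_eq_0)
    then have "(LINT z:?A|lborel. u (x + t *\<^sub>R z) / norm z powr p)
        = (\<integral>z. (\<Sum>k\<le>n. t ^ k * (indicator ?A z *\<^sub>R (coeff (P z) k / norm z powr p))) \<partial>lborel)"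
      unfolding set_lebesgue_integral_def
      by (simp add: sum_divide_distrib sum_distrib_left mult_ac)
    also have "\<dots> = (\<Sum>k\<le>n. \<integral>z. t ^ k * (indicator ?A z *\<^sub>R (coeff (P z) k / norm z powr p)) \<partial>lborel)"
      using integrable_annulus[OF assms(2) P(1)]
      by (intro Bochner_Integration.integral_sum integrable_mult_right) (simp add: set_integrable_def)
    also have "\<dots> = poly (\<Sum>k\<le>n. monom (c k) k) t"
      by (simp only: c_def set_lebesgue_integral_def poly_sum poly_monom integral_mult_right_zero mult.commute)
    finally show ?thesis .
  qed
  then show thesis by (rule that)
qed

section \<open>s-harmonic polynomials are harmonic\<close>

text \<open>A nonconstant polynomial has modulus at least 1 far out, by
  \<open>poly_infinity\<close>, which is incompatible with values tending to 0. A constant one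
  equals its limit. The two cases are told apart by whether \<open>q'\<close> vanishes.\<close>

lemma sequentially_null_poly:
  fixes q :: "real poly"
  assumes "filterlim X at_top sequentially" and "(\<lambda>n. poly q (X n)) \<longlonglongrightarrow> 0"
  shows "q = 0"
proof (cases q)
  case (pCons c q')
  show ?thesis
  proof (cases "q' = 0")
    case True
    then have "(\<lambda>_::nat. c) \<longlonglongrightarrow> 0"
      using assms(2) pCons by simp
    then show ?thesis
      using True pCons LIMSEQ_unique[OF tendsto_const] by force
  next
    case False
    obtain r where r: "\<And>z. r \<le> norm z \<Longrightarrow> 1 \<le> norm (poly q z)"
      using poly_infinity[OF False, of 1 c] pCons by blast
    have "eventually (\<lambda>n. r \<le> X n) sequentially"
      using assms(1) by (simp add: filterlim_at_top)
    moreover have "eventually (\<lambda>n. norm (poly q (X n)) < 1) sequentially"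
      using order_tendstoD(2)[OF tendsto_norm_zero[OF assms(2)]] by simp
    ultimately have "eventually (\<lambda>n. False) sequentially"
    proof eventually_elim
      case (elim n)
      then have "r \<le> norm (X n)" by simp
      with r elim show False by fastforce
    qed
    then show ?thesis by simp
  qed
qed

text \<open>The derivative of a constant is 0, so for nonzero t the factor t can be cancelled from
  the derivative formula. As t tends to 0 the weighted integral of the Laplacian tends to its value
  at x times the mass of the weight, and that mass is positive.\<close>

lemma hessian_trace_eq_0:
  fixes u :: "real^'n \<Rightarrow> real"
  assumes dg: "\<And>x. (u has_derivative (\<lambda>h. g x \<bullet> h)) (at x)"
    and dH: "\<And>x. (g has_derivative (\<lambda>h. H x *v h)) (at x)"
    and H: "continuous_on UNIV H"
    and ab: "0 < a" "a < b" and p: "2 < p"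
    and const: "\<And>t. (LINT z:ball 0 b - ball 0 a|lborel. u (x + t *\<^sub>R z) / norm z powr p) = c"
  shows "trace (H x) = 0"
proof -
  let ?\<phi> = "radial_primitive a b p :: real^'n \<Rightarrow> real"
  let ?D = "\<lambda>t. \<integral>z. ?\<phi> z * trace (H (x + t *\<^sub>R z)) \<partial>lborel"
  have D0: "?D t = 0" if "t \<noteq> 0" for t
    using DERIV_unique[OF annulus_integral_has_derivative[OF dg dH H ab p, of x t, unfolded const] DERIV_const] that
    by simp
  have trc: "continuous_on UNIV (\<lambda>x. trace (H x))"
    unfolding trace_def by (intro continuous_intros H)
  have \<phi>c: "continuous_on UNIV ?\<phi>"
    using radial_primitive_lipschitz[OF ab p] by (rule lipschitz_on_continuous_on)
  obtain T where T: "\<And>y. y \<in> cball x b \<Longrightarrow> \<bar>trace (H y)\<bar> \<le> T"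
    using compact_imp_bounded[OF compact_continuous_image[OF continuous_on_subset[OF trc] compact_cball[of x b]]]
    unfolding bounded_iff by (auto simp del: mem_cball)
  have int: "integrable lborel ?\<phi>"
    by (rule integrable_continuous_compact_support[of "cball 0 b"])
      (auto intro!: \<phi>c simp: radial_primitive_eq_0 ab)
  define X where "X n = inverse (real (Suc n))" for n
  have X: "X \<longlonglongrightarrow> 0" "X n \<noteq> 0" "\<bar>X n\<bar> \<le> 1" for n
    unfolding X_def using LIMSEQ_inverse_real_of_nat by (auto simp: field_simps)
  have "(\<lambda>n. ?D (X n)) \<longlonglongrightarrow> ?D 0"
  proof (rule integral_dominated_convergence)
    show "integrable lborel (\<lambda>z. ?\<phi> z * T)"
      using int by simp
    have meas: "(\<lambda>z. ?\<phi> z * trace (H (x + t *\<^sub>R z))) \<in> borel_measurable lborel" for t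
      by (auto intro!: borel_measurable_continuous_onI continuous_intros \<phi>c continuous_on_compose2[OF trc])
    show "(\<lambda>z. ?\<phi> z * trace (H (x + 0 *\<^sub>R z))) \<in> borel_measurable lborel"
      "\<And>n. (\<lambda>z. ?\<phi> z * trace (H (x + X n *\<^sub>R z))) \<in> borel_measurable lborel"
      by (rule meas)+
    show "AE z in lborel. (\<lambda>n. ?\<phi> z * trace (H (x + X n *\<^sub>R z))) \<longlonglongrightarrow> ?\<phi> z * trace (H (x + 0 *\<^sub>R z))"
      by (intro always_eventually allI tendsto_mult tendsto_const
          continuous_on_tendsto_compose[OF trc] tendsto_intros X) auto
    show "AE z in lborel. norm (?\<phi> z * trace (H (x + X n *\<^sub>R z))) \<le> ?\<phi> z * T" for n
    proof (intro always_eventually allI)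
      fix z :: "real^'n"
      show "norm (?\<phi> z * trace (H (x + X n *\<^sub>R z))) \<le> ?\<phi> z * T"
      proof (cases "norm z < b")
        case True
        have "\<bar>X n\<bar> * norm z \<le> 1 * norm z"
          by (intro mult_right_mono X) auto
        then have "\<bar>trace (H (x + X n *\<^sub>R z))\<bar> \<le> T"
          using True by (intro T) (simp add: dist_norm)
        then show ?thesis
          using radial_primitive_nonneg[OF ab p, of z] by (simp add: abs_mult mult_left_mono)
      next
        case False
        then show ?thesis using radial_primitive_eq_0[of a b z p] ab by simp
      qed
    qed
  qed
  then have "?D 0 = 0"
    using D0 X by (simp add: LIMSEQ_const_iff)
  then have "integral\<^sup>L lborel ?\<phi> * trace (H x) = 0" by simp
  \<comment> \<open>The weight is nonnegative and equals its positive value at 0 throughout the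
    inner ball.\<close>
  moreover have "0 < integral\<^sup>L lborel ?\<phi>"
  proof -
    have fin: "integrable lborel (\<lambda>z::real^'n. indicator (ball 0 a) z * ?\<phi> 0)"
      by (intro integrable_mult_left integrable_real_indicator) (auto intro: emeasure_bounded_finite[unfolded infinity_ennreal_def])
    have "0 < measure lborel (ball (0::real^'n) a) * ?\<phi> 0"
      using ab p by (intro mult_pos_pos content_ball_pos radial_primitive_pos) auto
    also have "\<dots> = integral\<^sup>L lborel (\<lambda>z::real^'n. indicator (ball 0 a) z * ?\<phi> 0)"
      by simp
    also have "\<dots> \<le> integral\<^sup>L lborel ?\<phi>"
    proof (rule integral_mono[OF fin int])
      show "indicator (ball 0 a) z * ?\<phi> 0 \<le> ?\<phi> z" for z :: "real^'n"
        using radial_primitive_nonneg[OF ab p, of z] ab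
        by (auto simp: indicator_def radial_primitive_def)
    qed
    finally show ?thesis .
  qed
  ultimately show ?thesis by simp
qed

text \<open>The linear coefficient is the derivative at 0. Extracting the full square matters later:
  it turns r^(-2s) into r^(2-2s), whose exponent is positive.\<close>

lemma poly_sub_const_eq_quadratic:
  fixes P :: "real poly"
  assumes "(poly P has_real_derivative 0) (at 0)"
  obtains q where "\<And>t. poly P t = poly P 0 + t\<^sup>2 * poly q t"
proof -
  obtain a b q where P: "P = pCons a (pCons b q)"
    by (metis pCons_cases)
  have "poly (pderiv P) 0 = 0"
    using DERIV_unique[OF poly_DERIV assms] .
  then have "b = 0" by (simp add: P pderiv_pCons)
  then have "poly P t = poly P 0 + t\<^sup>2 * poly q t" for t
    by (simp add: P power2_eq_square algebra_simps)
  then show thesis by (rule that)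
qed

lemma polynomial_frac_harmonic_imp_classical_harmonic:
  fixes u :: "real^'n \<Rightarrow> real"
  assumes u: "real_polynomial_function u" and s: "0 < s" "s < 1" and p: "2 < real CARD('n) + 2 * s"
    and frac: "\<And>x. frac_lap_at s u x 0"
  shows "classical_harmonic u"
proof -
  define p where "p = real CARD('n) + 2 * s"
  have p2: "2 < p" using p by (simp add: p_def)
  obtain g H where dg: "\<And>x. (u has_derivative (\<lambda>h. g x \<bullet> h)) (at x)"
    and dH: "\<And>x. (g has_derivative (\<lambda>h. H x *v h)) (at x)" and H: "continuous_on UNIV H"
    using real_polynomial_function_hessian[OF u] by blast
  have uc: "continuous_on UNIV u"
    using has_derivative_continuous_on[OF dg] by auto
  \<comment> \<open>Allows passing from the limit of the normalized integrals to that of the bare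
    ones; both Gamma arguments are positive since 0 < s < 1.\<close>
  have cpos: "c_const CARD('n) s \<noteq> 0"
  proof -
    have "Gamma ((real CARD('n) + 2 * s) / 2) > 0" "Gamma (1 - s) > 0"
      using s p by (auto intro!: Gamma_real_pos)
    then show ?thesis
      unfolding c_const_def using s by (intro less_imp_neq[symmetric] divide_pos_pos mult_pos_pos) auto
  qed
  have "trace (H x) = 0" for x
  proof -
    define f where "f z = u x - u (x + z)" for z
    define J where "J a b = (LINT z:ball 0 b - ball 0 a|lborel. f z / norm z powr p)" for a b
    \<comment> \<open>The shell 1 \<le> |z| < 2 serves as reference: every shell r \<le> |z| < 2r is
      its dilate.\<close>
    define K where "K t = (LINT z:ball 0 2 - ball 0 1|lborel. u (x + t *\<^sub>R z) / norm z powr p)" for t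
    have fc: "continuous_on UNIV f"
      unfolding f_def by (intro continuous_intros continuous_on_compose2[OF uc]) auto
    obtain P where P: "\<And>t. K t = poly P t"
      using annulus_integral_eq_poly[OF u zero_less_one, of 2 x p] unfolding K_def by blast
    have "(poly P has_real_derivative 0) (at 0)"
      unfolding P[symmetric, abs_def] using annulus_integral_has_derivative[OF dg dH H, of 1 2 p x 0] p2 by (simp add: K_def[abs_def])
    then obtain q where q: "\<And>t. K t = K 0 + t\<^sup>2 * poly q t"
      unfolding P using poly_sub_const_eq_quadratic by blast
    \<comment> \<open>Dilation contributes r^(-2s) and K(0) - K(r) contributes -r^2 q(r).\<close>
    have JK: "J r (2 * r) = - (r powr (2 - 2 * s) * poly q r)" if "0 < r" for r
    proof -
      have "J r (2 * r) = r powr (- 2 * s) * (LINT z:ball 0 2 - ball 0 1|lborel. f (r *\<^sub>R z) / norm z powr p)"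
        using integral_annulus_scaleR[OF that zero_less_one fc, of 2 p]
        by (simp add: J_def mult.commute p_def)
      also have "(LINT z:ball 0 2 - ball 0 1|lborel. f (r *\<^sub>R z) / norm z powr p) = K 0 - K r"
      proof -
        have int: "set_integrable lborel (ball 0 2 - ball 0 1) (\<lambda>z. u (x + t *\<^sub>R z) / norm z powr p)" for t
          by (intro integrable_annulus continuous_intros continuous_on_compose2[OF uc]) auto
        show ?thesis
          using set_integral_diff(2)[OF int[of 0] int[of r]]
          by (simp add: K_def f_def diff_divide_distrib)
      qed
      also have "K 0 - K r = - (r powr 2 * poly q r)"
        using q[of r] that by simp
      also have "r powr (- 2 * s) * - (r powr 2 * poly q r) = - (r powr (2 - 2 * s) * poly q r)"
        using powr_add[of r "- 2 * s" 2] by simp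
      finally show ?thesis .
    qed
    have Jlim: "((\<lambda>\<epsilon>. J \<epsilon> (1/\<epsilon>)) \<longlongrightarrow> 0) (at_right 0)"
    proof -
      have "((\<lambda>\<epsilon>. inverse (c_const CARD('n) s) * (c_const CARD('n) s * J \<epsilon> (1/\<epsilon>)))
          \<longlongrightarrow> inverse (c_const CARD('n) s) * 0) (at_right 0)"
        using frac[of x] by (intro tendsto_mult tendsto_const) (simp add: frac_lap_at_def J_def f_def p_def)
      then show ?thesis using cpos by (simp add: mult.assoc[symmetric])
    qed
    define X :: "nat \<Rightarrow> real" where "X n = 2 ^ n" for n
    have X1: "1 \<le> X n" for n by (simp add: X_def)
    then have X0: "0 < X n" for n by (meson less_le_trans zero_less_one)
    have Xtop: "filterlim X at_top sequentially"
      unfolding X_def by real_asymp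
    have Xinv: "filterlim (\<lambda>n. inverse (X n)) (at_right 0) sequentially"
      by (rule filterlim_compose[OF filterlim_inverse_at_right_top Xtop])
    have Jn: "(\<lambda>n. J (inverse (X n)) (X n)) \<longlonglongrightarrow> 0"
      using filterlim_compose[OF Jlim Xinv] by (simp add: inverse_eq_divide)
    \<comment> \<open>Half-open annuli are disjoint and fit together without gaps.\<close>
    have split: "J a c = J a b + J b c" if "0 < a" "a \<le> b" "b \<le> c" for a b c
    proof -
      have "ball (0::real^'n) c - ball 0 a = (ball 0 b - ball 0 a) \<union> (ball 0 c - ball 0 b)"
        using that by auto
      then show ?thesis
        unfolding J_def using that
        by (simp only:) (intro set_integral_Un integrable_annulus fc; auto)
    qed
    \<comment> \<open>Passing from scale n to n + 1 adds an inner shell from 2^(-n-1) to 2^(-n) and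
      an outer one from 2^n to 2^(n+1). \<open>JK\<close> evaluates both, and the identity is solved
      for the outer contribution.\<close>
    have tail: "X n powr (2 - 2 * s) * poly q (X n)
        = J (inverse (X n)) (X n) - J (inverse (X (Suc n))) (X (Suc n))
          - inverse (X (Suc n)) powr (2 - 2 * s) * poly q (inverse (X (Suc n)))" for n
    proof -
      have S: "X (Suc n) = 2 * X n" by (simp add: X_def)
      have le: "inverse (X (Suc n)) \<le> inverse (X n)" "inverse (X n) \<le> X n" "X n \<le> X (Suc n)"
        using X1[of n] X0[of n] S mult_mono[of 1 "X n" 1 "X n"] by (auto simp: field_simps)
      have "J (inverse (X (Suc n))) (X (Suc n)) = J (inverse (X (Suc n))) (inverse (X n))
          + J (inverse (X n)) (X n) + J (X n) (X (Suc n))"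
        using split[of "inverse (X (Suc n))" "inverse (X n)" "X (Suc n)"]
          split[of "inverse (X n)" "X n" "X (Suc n)"] le X0 by auto
      moreover have "J (X n) (X (Suc n)) = - (X n powr (2 - 2 * s) * poly q (X n))"
        using JK[OF X0[of n]] S by simp
      moreover have "J (inverse (X (Suc n))) (inverse (X n))
          = - (inverse (X (Suc n)) powr (2 - 2 * s) * poly q (inverse (X (Suc n))))"
        using JK[of "inverse (X (Suc n))"] X0[of "Suc n"] S by simp
      ultimately show ?thesis by simp
    qed
    have "(\<lambda>n. inverse (X (Suc n)) powr (2 - 2 * s) * poly q (inverse (X (Suc n)))) \<longlonglongrightarrow> 0 * poly q 0"
    proof (intro tendsto_mult)
      have "(\<lambda>n. inverse (X n)) \<longlonglongrightarrow> 0"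
        using Xinv by (simp add: filterlim_at)
      then have inv: "(\<lambda>n. inverse (X (Suc n))) \<longlonglongrightarrow> 0"
        by (rule LIMSEQ_Suc)
      show "(\<lambda>n. inverse (X (Suc n)) powr (2 - 2 * s)) \<longlonglongrightarrow> 0"
        using s X0 by (intro tendsto_zero_powrI[OF inv tendsto_const]) (auto intro!: always_eventually less_imp_le)
      show "(\<lambda>n. poly q (inverse (X (Suc n)))) \<longlonglongrightarrow> poly q 0"
        using inv by (rule tendsto_poly)
    qed
    from tendsto_diff[OF tendsto_diff[OF Jn LIMSEQ_Suc[OF Jn]] this]
    have lim: "(\<lambda>n. X n powr (2 - 2 * s) * poly q (X n)) \<longlonglongrightarrow> 0"
      unfolding tail by simp
    have "(\<lambda>n. poly q (X n)) \<longlonglongrightarrow> 0"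
    \<comment> \<open>The factor X(n)^(2-2s) is at least 1, so dropping it only decreases the
      modulus.\<close>
    proof (rule Lim_null_comparison[OF _ tendsto_rabs_zero[OF lim]], intro always_eventually allI)
      fix n
      have "1 \<le> X n powr (2 - 2 * s)"
        using X1 s by (intro ge_one_powr_ge_zero) auto
      then show "norm (poly q (X n)) \<le> \<bar>X n powr (2 - 2 * s) * poly q (X n)\<bar>"
        using mult_right_mono[of 1 "X n powr (2 - 2 * s)" "\<bar>poly q (X n)\<bar>"] by (simp add: abs_mult)
    qed
    then have "q = 0"
      using Xtop by (rule sequentially_null_poly[rotated])
    then have "K t = K 0" for t
      using q by simp
    then show ?thesis
      using hessian_trace_eq_0[OF dg dH H, of 1 2 p x "K 0"] p2 by (simp add: K_def)
  qed
  then show ?thesis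
    unfolding classical_harmonic_def trace_def using dg dH H by blast
qed

theorem theorem1p1:
  fixes s :: real
  assumes "CARD('n::finite) \<ge> 2" and "0 < s" and "s \<le> 1"
  shows "(\<forall>m::nat. (H_s_m s m :: (real^'n \<Rightarrow> real) set) = H_s_m 1 m)
         \<and> (H_s 1 :: (real^'n \<Rightarrow> real) set) \<subseteq> H_s s"
proof (cases "s = 1")
  case False
  \<comment> \<open>Strict because s > 0; it makes the exponent 2 - p of the radial primitive
    negative. The remaining case s = 1 is trivial and is closed at the end.\<close>
  have p: "2 < real CARD('n) + 2 * s"
    using assms by linarith
  have "s_harmonic s u" if "s_harmonic 1 u" for u :: "real^'n \<Rightarrow> real"
    using that False classical_harmonic_imp_frac_lap_at[OF _ p] by (simp add: s_harmonic_def)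
  moreover have "s_harmonic 1 u" if "hom_poly m u" "s_harmonic s u" for m and u :: "real^'n \<Rightarrow> real"
    using that False assms
      polynomial_frac_harmonic_imp_classical_harmonic[OF hom_poly_imp_real_polynomial_function _ _ p]
    by (auto simp: s_harmonic_def)
  ultimately show ?thesis
    unfolding H_s_def H_s_m_def by blast
qed simp

end
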